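(* Let $d_1,\dots,d_n$ be a sequence of possibly dependent, square-integrable real random variables, and let $e_1,\dots,e_n$ be a decoupled sequence of $d_1,\dots,d_n$ (with respect to an increasing sequence of $\sigma$-algebras $\{\mathcal{F}_i\}_{0\le i\le n}$ and given a $\sigma$-algebra $\mathcal{G}$). Then $$\operatorname{Var}\left(\sum_{i=1}^n d_i\right)\le 2\operatorname{Var}\left(\sum_{i=1}^n e_i\right).$$
   Context: All random variables are defined on a probability space $(\Omega,\mathcal{F},\mathbb{P})$ and are square-integrable. $\mathcal{L}(X\mid\mathcal{H})$ denotes the conditional law of $X$ given a $\sigma$-algebra $\mathcal{H}$. Let $\mathcal{F}_0\subseteq\mathcal{F}_1\subseteq\dots\subseteq\mathcal{F}_n\subseteq\mathcal{F}$ be $\sigma$-algebras and let $\{d_i\}_{1\le i\le n}$, $\{e_i\}_{1\le i\le n}$ be sequences adapted to $\{\mathcal{F}_i\}$ (i.e. $d_i,e_i$ are $\mathcal{F}_i$-measurable). (Tangent) $\{d_i\}$ is tangent to $\{e_i\}$ with respect to $\{\mathcal{F}_i\}$ if $\mathcal{L}(d_i\mid\mathcal{F}_{i-1})=\mathcal{L}(e_i\mid\mathcal{F}_{i-1})$ for all $i$. (Conditionally independent, CI) $\{e_i\}$ is CI if there is a $\sigma$-algebra $\mathcal{G}\subseteq\mathcal{F}$ such that $e_1,\dots,e_n$ are conditionally independent given $\mathcal{G}$ and $\mathcal{L}(e_i\mid\mathcal{F}_{i-1})=\mathcal{L}(e_i\mid\mathcal{G})$ for all $i$. (Decoupled) $\{e_i\}$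 is a decoupled sequence (decoupled version) of $\{d_i\}$, given $\mathcal{G}$, if $\{e_i\}$ is CI with this $\mathcal{G}$ and is tangent to $\{d_i\}$ with respect to $\{\mathcal{F}_i\}$. *)

theory Defs
  imports "HOL-Probability.Probability"
begin

text \<open>
  Sub-sigma-algebras of \<open>M\<close> are represented, as in the library, by measures \<open>H\<close> with
  \<open>subalgebra M H\<close>; only \<open>space H\<close> and \<open>sets H\<close> matter.
\<close>

definition cond_law :: "'a measure \<Rightarrow> 'a measure \<Rightarrow> ('a \<Rightarrow> real) \<Rightarrow> real set \<Rightarrow> 'a \<Rightarrow> real"
  where "cond_law M H X B = real_cond_exp M H (indicat_real (X -` B \<inter> space M))"

text \<open>
  Conditional probabilities are only determined almost surely, so equality of conditional laws is
  almost sure equality of \<open>P(X \<in> B | H)\<close> and \<open>P(Y \<in> B | K)\<close> for every Borel set \<open>B\<close>. As the Borel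
  sets of the reals are countably generated, this is the same as almost sure equality of regular
  versions. \<open>H\<close> and \<open>K\<close> may differ.
\<close>

definition cond_law_eq ::
  "'a measure \<Rightarrow> 'a measure \<Rightarrow> ('a \<Rightarrow> real) \<Rightarrow> 'a measure \<Rightarrow> ('a \<Rightarrow> real) \<Rightarrow> bool"
  where "cond_law_eq M H X K Y \<longleftrightarrow>
    (\<forall>B\<in>sets borel. AE \<omega> in M. cond_law M H X B \<omega> = cond_law M K Y B \<omega>)"

definition cond_indep_vars :: "'a measure \<Rightarrow> 'a measure \<Rightarrow> ('i \<Rightarrow> 'a \<Rightarrow> real) \<Rightarrow> 'i set \<Rightarrow> bool"
  where "cond_indep_vars M G X I \<longleftrightarrow>
    (\<forall>J B. J \<subseteq> I \<longrightarrow> J \<noteq> {} \<longrightarrow> finite J \<longrightarrow> (\<forall>j\<in>J. B j \<in> sets borel) \<longrightarrow>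
      (AE \<omega> in M. real_cond_exp M G (indicat_real (\<Inter>j\<in>J. X j -` B j \<inter> space M)) \<omega>
                    = (\<Prod>j\<in>J. cond_law M G (X j) (B j) \<omega>)))"

definition sigma_filtration :: "'a measure \<Rightarrow> nat \<Rightarrow> (nat \<Rightarrow> 'a measure) \<Rightarrow> bool"
  where "sigma_filtration M n F \<longleftrightarrow>
    (\<forall>i\<le>n. subalgebra M (F i)) \<and> (\<forall>i j. i \<le> j \<longrightarrow> j \<le> n \<longrightarrow> sets (F i) \<subseteq> sets (F j))"

definition adapted_seq :: "nat \<Rightarrow> (nat \<Rightarrow> 'a measure) \<Rightarrow> (nat \<Rightarrow> 'a \<Rightarrow> real) \<Rightarrow> bool"
  where "adapted_seq n F X \<longleftrightarrow> (\<forall>i\<in>{1..n}. X i \<in> borel_measurable (F i))"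

definition tangent ::
  "'a measure \<Rightarrow> nat \<Rightarrow> (nat \<Rightarrow> 'a measure) \<Rightarrow> (nat \<Rightarrow> 'a \<Rightarrow> real) \<Rightarrow> (nat \<Rightarrow> 'a \<Rightarrow> real) \<Rightarrow> bool"
  where "tangent M n F d e \<longleftrightarrow>
    (\<forall>i\<in>{1..n}. cond_law_eq M (F (i - 1)) (d i) (F (i - 1)) (e i))"

definition CI_given ::
  "'a measure \<Rightarrow> nat \<Rightarrow> (nat \<Rightarrow> 'a measure) \<Rightarrow> 'a measure \<Rightarrow> (nat \<Rightarrow> 'a \<Rightarrow> real) \<Rightarrow> bool"
  where "CI_given M n F G e \<longleftrightarrow>
    subalgebra M G \<and> cond_indep_vars M G e {1..n} \<and>
    (\<forall>i\<in>{1..n}. cond_law_eq M (F (i - 1)) (e i) G (e i))"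

definition decoupled_seq ::
  "'a measure \<Rightarrow> nat \<Rightarrow> (nat \<Rightarrow> 'a measure) \<Rightarrow> 'a measure \<Rightarrow>
    (nat \<Rightarrow> 'a \<Rightarrow> real) \<Rightarrow> (nat \<Rightarrow> 'a \<Rightarrow> real) \<Rightarrow> bool"
  where "decoupled_seq M n F G d e \<longleftrightarrow> CI_given M n F G e \<and> tangent M n F d e"

definition square_integrable :: "'a measure \<Rightarrow> ('a \<Rightarrow> real) \<Rightarrow> bool"
  where "square_integrable M X \<longleftrightarrow>
    X \<in> borel_measurable M \<and> integrable M (\<lambda>\<omega>. (X \<omega>)\<^sup>2)"

end

theory Submission
  imports Defs
begin

text \<open>
  Let \<open>u\<^sub>i = E[d\<^sub>i | F\<^sub>i\<^sub>-\<^sub>1]\<close>, which is almost surely equal to \<open>v\<^sub>i = E[e\<^sub>i | G]\<close>. The differences \<open>d\<^sub>i - u\<^sub>i\<close>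
  are orthogonal because they are martingale differences, the differences \<open>e\<^sub>i - v\<^sub>i\<close> because of the
  conditional independence, and corresponding terms have the same second moment. Hence
  \<open>S = \<Sum>(d\<^sub>i - u\<^sub>i)\<close> and \<open>S' = \<Sum>(e\<^sub>i - v\<^sub>i)\<close> have the same second moment. With \<open>T = \<Sum>u\<^sub>i\<close>, which is
  almost surely \<open>G\<close>-measurable and so uncorrelated with \<open>S'\<close>, this gives
  \<open>Var (S + T) \<le> 2 E[S\<^sup>2] + 2 Var T = 2 Var (S' + T)\<close>.
\<close>

section \<open>Conditional monotone convergence and extension from indicators to functions\<close>

lemma (in prob_space) sigma_finite_subalgebraI:
  assumes "subalgebra M H"
  shows "sigma_finite_subalgebra M H"
  by (intro finite_measure_subalgebra_is_sigma_finite finite_measure_subalgebra.intro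
      finite_measure_subalgebra_axioms.intro assms) unfold_locales

text \<open>Conditional monotone convergence. A conditional expectation is characterised by its
  integrals over the sets of \<open>F\<close>; there ordinary monotone convergence applies both to
  \<open>U\<close> and to its conditional expectations.\<close>

lemma (in sigma_finite_subalgebra) nn_cond_exp_SUP:
  fixes U :: "nat \<Rightarrow> 'a \<Rightarrow> ennreal"
  assumes [measurable]: "\<And>i. U i \<in> borel_measurable M" and "incseq U"
  shows "AE x in M. nn_cond_exp M F (\<lambda>x. SUP i. U i x) x = (SUP i. nn_cond_exp M F (U i) x)"
proof -
  have "AE x in M. (SUP i. nn_cond_exp M F (U i) x) = nn_cond_exp M F (\<lambda>x. SUP i. U i x) x"
  proof (rule nn_cond_exp_charact)
    fix A assume A [measurable]: "A \<in> sets F"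
    then have AM [measurable]: "A \<in> sets M" using subalg by (auto simp: subalgebra_def)
    \<comment> \<open>Versions of conditional expectations are ordered only almost surely, which is
      why the almost-everywhere form of monotone convergence is used below.\<close>
    have mono: "AE x in M. nn_cond_exp M F (U i) x \<le> nn_cond_exp M F (U (Suc i)) x" for i
      using \<open>incseq U\<close> by (intro nn_cond_exp_mono) (auto simp: incseq_Suc_iff le_fun_def)
    have "(\<integral>\<^sup>+ x \<in> A. (SUP i. U i x) \<partial>M) = (\<integral>\<^sup>+ x. (SUP i. U i x * indicator A x) \<partial>M)"
      by (simp add: SUP_mult_right_ennreal)
    also have "\<dots> = (SUP i. \<integral>\<^sup>+ x. U i x * indicator A x \<partial>M)"
      using \<open>incseq U\<close>
      by (intro nn_integral_monotone_convergence_SUP_AE)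
         (auto simp: incseq_Suc_iff le_fun_def intro!: mult_right_mono)
    also have "\<dots> = (SUP i. \<integral>\<^sup>+ x. nn_cond_exp M F (U i) x * indicator A x \<partial>M)"
      using nn_cond_exp_intg[of "indicator A"] by (simp add: mult.commute)
    also have "\<dots> = (\<integral>\<^sup>+ x. (SUP i. nn_cond_exp M F (U i) x * indicator A x) \<partial>M)"
    proof (intro nn_integral_monotone_convergence_SUP_AE[symmetric])
      show "AE x in M. nn_cond_exp M F (U i) x * indicator A x
          \<le> nn_cond_exp M F (U (Suc i)) x * indicator A x" for i
        using mono[of i] by eventually_elim (simp add: mult_right_mono)
    qed simp
    also have "\<dots> = (\<integral>\<^sup>+ x \<in> A. (SUP i. nn_cond_exp M F (U i) x) \<partial>M)"
      by (simp add: SUP_mult_right_ennreal)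
    finally show "(\<integral>\<^sup>+ x \<in> A. (SUP i. U i x) \<partial>M)
      = (\<integral>\<^sup>+ x \<in> A. (SUP i. nn_cond_exp M F (U i) x) \<partial>M)" .
  qed auto
  then show ?thesis by auto
qed

text \<open>
  With all factors \<open>1\<close> this extends equality of conditional laws to functions; with \<open>h\<close> and \<open>k'\<close> coming
  from a second variable it extends conditional independence, one variable at a time.
\<close>

lemma (in prob_space) nn_cond_exp_eq_extend:
  fixes X Y :: "'a \<Rightarrow> 'b::topological_space" and f :: "'b \<Rightarrow> ennreal"
  assumes "subalgebra M H" "subalgebra M K"
    and [measurable]: "X \<in> borel_measurable M" "Y \<in> borel_measurable M"
      "h \<in> borel_measurable M" "h' \<in> borel_measurable M"
    and ind: "\<And>B. B \<in> sets borel \<Longrightarrow>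
      AE x in M. nn_cond_exp M H (\<lambda>x. indicator B (X x) * h x) x * k x
               = nn_cond_exp M K (\<lambda>x. indicator B (Y x) * h' x) x * k' x"
    and f: "f \<in> borel_measurable borel"
  shows "AE x in M. nn_cond_exp M H (\<lambda>x. f (X x) * h x) x * k x
                  = nn_cond_exp M K (\<lambda>x. f (Y x) * h' x) x * k' x"
proof -
  interpret H: sigma_finite_subalgebra M H by (rule sigma_finite_subalgebraI) fact
  interpret K: sigma_finite_subalgebra M K by (rule sigma_finite_subalgebraI) fact
  show ?thesis using f
  proof (induction f rule: borel_measurable_induct)
    case (cong f g)
    then have "f = g" by auto
    with cong show ?case by simp
  next
    case (set A)
    then show ?case using ind by simp
  next
    case (mult u c)
    have [measurable]: "u \<in> borel_measurable borel" by fact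
    have "AE x in M. c * nn_cond_exp M H (\<lambda>x. u (X x) * h x) x
          = nn_cond_exp M H (\<lambda>x. c * (u (X x) * h x)) x"
        "AE x in M. c * nn_cond_exp M K (\<lambda>x. u (Y x) * h' x) x
          = nn_cond_exp M K (\<lambda>x. c * (u (Y x) * h' x)) x"
      by (intro H.nn_cond_exp_prod K.nn_cond_exp_prod; measurable)+
    with mult.IH show ?case
      unfolding mult.assoc[of c] by eventually_elim (metis mult.assoc)
  next
    case (add u v)
    have [measurable]: "u \<in> borel_measurable borel" "v \<in> borel_measurable borel" by fact+
    have "AE x in M. nn_cond_exp M H (\<lambda>x. v (X x) * h x + u (X x) * h x) x
          = nn_cond_exp M H (\<lambda>x. v (X x) * h x) x + nn_cond_exp M H (\<lambda>x. u (X x) * h x) x"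
        "AE x in M. nn_cond_exp M K (\<lambda>x. v (Y x) * h' x + u (Y x) * h' x) x
          = nn_cond_exp M K (\<lambda>x. v (Y x) * h' x) x + nn_cond_exp M K (\<lambda>x. u (Y x) * h' x) x"
      by (rule AE_symmetric, (intro H.nn_cond_exp_sum K.nn_cond_exp_sum; measurable))+
    with add.IH show ?case
      unfolding distrib_right[of "v _" "u _"] by eventually_elim (simp add: distrib_right)
  next
    case (seq U)
    have [measurable]: "U i \<in> borel_measurable borel" for i by fact
    have "incseq (\<lambda>i x. U i (X x) * h x)" "incseq (\<lambda>i x. U i (Y x) * h' x)"
      using seq by (auto simp: incseq_def le_fun_def intro!: mult_right_mono)
    then have "AE x in M. nn_cond_exp M H (\<lambda>x. (SUP i. U i (X x) * h x)) x
          = (SUP i. nn_cond_exp M H (\<lambda>x. U i (X x) * h x) x)"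
        "AE x in M. nn_cond_exp M K (\<lambda>x. (SUP i. U i (Y x) * h' x)) x
          = (SUP i. nn_cond_exp M K (\<lambda>x. U i (Y x) * h' x) x)"
      by (intro H.nn_cond_exp_SUP K.nn_cond_exp_SUP; simp)+
    \<comment> \<open>The induction hypotheses are countably many, so they hold together off one
      null set and the supremum over \<open>i\<close> can be taken pointwise.\<close>
    moreover have "AE x in M. \<forall>i. nn_cond_exp M H (\<lambda>x. U i (X x) * h x) x * k x
                  = nn_cond_exp M K (\<lambda>x. U i (Y x) * h' x) x * k' x"
      using seq by (simp add: AE_all_countable)
    ultimately show ?case
      by (auto simp: SUP_mult_right_ennreal image_comp)
  qed
qed

section \<open>From conditional laws to conditional expectations\<close>

text \<open>\<open>real_cond_exp\<close> is a difference of two nonnegative conditional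
  expectations; the one belonging to \<open>- f\<close> vanishes because \<open>ennreal\<close> maps
  nonpositive numbers to 0.\<close>

lemma (in sigma_finite_subalgebra) real_cond_exp_nonneg:
  assumes "f \<in> borel_measurable M" "\<And>x. f x \<ge> 0"
  shows "AE x in M. real_cond_exp M F f x = enn2real (nn_cond_exp M F (\<lambda>x. ennreal (f x)) x)"
proof -
  have "AE x in M. 0 = nn_cond_exp M F (\<lambda>x. 0) x"
    by (rule nn_cond_exp_F_meas) simp
  then show ?thesis
    using assms(2) by (auto simp: real_cond_exp_def ennreal_neg)
qed

text \<open>A bridge between the real conditional probabilities in \<open>cond_law\<close> and
  \<open>ennreal\<close>-valued ones. As \<open>enn2real\<close> maps infinity to 0, finiteness has
  to come first, from comparison with the conditional expectation of 1. The target space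
  \<open>N\<close> is general so that pairs of variables are covered as well.\<close>

lemma (in sigma_finite_subalgebra) nn_cond_exp_indicator:
  assumes [measurable]: "X \<in> measurable M N" "B \<in> sets N"
  shows "AE x in M. nn_cond_exp M F (\<lambda>x. indicator B (X x)) x
    = ennreal (real_cond_exp M F (indicat_real (X -` B \<inter> space M)) x)"
proof -
  let ?I = "indicat_real (X -` B \<inter> space M)"
  have "AE x in M. nn_cond_exp M F (\<lambda>x. ennreal (?I x)) x \<le> nn_cond_exp M F (\<lambda>x. 1) x"
    by (intro nn_cond_exp_mono) (auto simp: indicator_def)
  moreover have "AE x in M. 1 = nn_cond_exp M F (\<lambda>x. 1) x"
    by (rule nn_cond_exp_F_meas) simp
  moreover have "AE x in M. nn_cond_exp M F (\<lambda>x. indicator B (X x)) x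
      = nn_cond_exp M F (\<lambda>x. ennreal (?I x)) x"
    by (rule nn_cond_exp_cong) (auto simp: indicator_def)
  moreover have "AE x in M. real_cond_exp M F ?I x
      = enn2real (nn_cond_exp M F (\<lambda>x. ennreal (?I x)) x)"
    by (rule real_cond_exp_nonneg) auto
  ultimately show ?thesis
    by eventually_elim (auto simp: ennreal_enn2real_if dest: neq_top_trans[OF ennreal_one_neq_top])
qed

text \<open>Conditional probabilities determine the conditional expectations of the positive and
  negative parts of \<open>\<phi>\<close>, and \<open>real_cond_exp\<close> is assembled from these.
  The theorem takes the identity and the square for \<open>\<phi>\<close>, to compare conditional
  first and second moments.\<close>

lemma (in prob_space) cond_law_eq_real_cond_exp:
  assumes "cond_law_eq M H X K Y" "subalgebra M H" "subalgebra M K"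
    and [measurable]: "X \<in> borel_measurable M" "Y \<in> borel_measurable M"
      "\<phi> \<in> borel_measurable borel"
  shows "AE x in M. real_cond_exp M H (\<lambda>x. \<phi> (X x)) x = real_cond_exp M K (\<lambda>x. \<phi> (Y x)) x"
proof -
  interpret H: sigma_finite_subalgebra M H by (rule sigma_finite_subalgebraI) fact
  interpret K: sigma_finite_subalgebra M K by (rule sigma_finite_subalgebraI) fact
  have "AE x in M. nn_cond_exp M H (\<lambda>x. f (X x)) x = nn_cond_exp M K (\<lambda>x. f (Y x)) x"
    if "f \<in> borel_measurable borel" for f :: "real \<Rightarrow> ennreal"
  proof -
    have "AE x in M. nn_cond_exp M H (\<lambda>x. f (X x) * 1) x * 1
                   = nn_cond_exp M K (\<lambda>x. f (Y x) * 1) x * 1"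
    proof (rule nn_cond_exp_eq_extend[OF assms(2,3) _ _ _ _ _ that])
      fix B :: "real set" assume B: "B \<in> sets borel"
      have "AE x in M. cond_law M H X B x = cond_law M K Y B x"
        using assms(1) B by (auto simp: cond_law_eq_def)
      then show "AE x in M. nn_cond_exp M H (\<lambda>x. indicator B (X x) * 1) x * 1
                   = nn_cond_exp M K (\<lambda>x. indicator B (Y x) * 1) x * 1"
        using H.nn_cond_exp_indicator[of X borel B] K.nn_cond_exp_indicator[of Y borel B] B
        by (auto simp: cond_law_def)
    qed simp_all
    then show ?thesis by simp
  qed
  from this[of "\<lambda>x. ennreal (\<phi> x)"] this[of "\<lambda>x. ennreal (- \<phi> x)"] show ?thesis
    unfolding real_cond_exp_def by auto
qed

section \<open>Product formulas under conditional independence\<close>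

text \<open>For indicators this is conditional independence over the index set
  \<open>{i, j}\<close>. The extension to functions runs first over \<open>X j\<close>, with an
  event of \<open>X i\<close> held fixed, and then over \<open>X i\<close>, with
  \<open>g (X j)\<close> held fixed.\<close>

lemma (in prob_space) cond_indep_vars_nn_cond_exp:
  assumes ci: "cond_indep_vars M G X I" and G: "subalgebra M G"
    and ij: "i \<in> I" "j \<in> I" "i \<noteq> j"
    and [measurable]: "X i \<in> borel_measurable M" "X j \<in> borel_measurable M"
      "f \<in> borel_measurable borel" "g \<in> borel_measurable borel"
  shows "AE x in M. nn_cond_exp M G (\<lambda>x. f (X i x) * g (X j x)) x
    = nn_cond_exp M G (\<lambda>x. f (X i x)) x * nn_cond_exp M G (\<lambda>x. g (X j x)) x"
proof -
  interpret G: sigma_finite_subalgebra M G by (rule sigma_finite_subalgebraI) fact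
  have ind: "AE x in M. nn_cond_exp M G (\<lambda>x. indicator A (X i x) * indicator B (X j x)) x
      = nn_cond_exp M G (\<lambda>x. indicator A (X i x)) x * nn_cond_exp M G (\<lambda>x. indicator B (X j x)) x"
    if [measurable]: "A \<in> sets borel" "B \<in> sets borel" for A B
  proof -
    let ?B = "\<lambda>k. if k = i then A else B"
    let ?I = "indicat_real (\<Inter>k\<in>{i, j}. X k -` ?B k \<inter> space M)"
    \<comment> \<open>Read as the preimage of a rectangle under the pair, the joint event falls
      under \<open>nn_cond_exp_indicator\<close>.\<close>
    have preimage: "(\<Inter>k\<in>{i, j}. X k -` ?B k \<inter> space M) = (\<lambda>x. (X i x, X j x)) -` (A \<times> B) \<inter> space M"
      using ij by auto
    have "AE x in M. real_cond_exp M G ?I x = (\<Prod>k\<in>{i, j}. cond_law M G (X k) (?B k) x)"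
      using ij that by (intro ci[unfolded cond_indep_vars_def, rule_format]) auto
    \<comment> \<open>\<open>ennreal\<close> truncates negative values, so it is split over the
      product with the help of a nonnegative factor.\<close>
    moreover have "AE x in M. 0 \<le> cond_law M G (X i) A x"
      unfolding cond_law_def by (intro G.real_cond_exp_pos) auto
    moreover have "AE x in M. nn_cond_exp M G (\<lambda>x. indicator (A \<times> B) (X i x, X j x)) x
        = ennreal (real_cond_exp M G
            (indicat_real ((\<lambda>x. (X i x, X j x)) -` (A \<times> B) \<inter> space M)) x)"
      by (rule G.nn_cond_exp_indicator[where N="borel \<Otimes>\<^sub>M borel"]) measurable
    moreover have "AE x in M. nn_cond_exp M G (\<lambda>x. indicator A (X i x)) x
        = ennreal (cond_law M G (X i) A x)"
      unfolding cond_law_def by (rule G.nn_cond_exp_indicator[where N=borel]) measurable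
    moreover have "AE x in M. nn_cond_exp M G (\<lambda>x. indicator B (X j x)) x
        = ennreal (cond_law M G (X j) B x)"
      unfolding cond_law_def by (rule G.nn_cond_exp_indicator[where N=borel]) measurable
    ultimately show ?thesis
      unfolding indicator_times fst_conv snd_conv preimage
      by eventually_elim (use ij in \<open>simp add: ennreal_mult'\<close>)
  qed
  have "AE x in M. nn_cond_exp M G (\<lambda>x. f (X i x) * g (X j x)) x * 1
    = nn_cond_exp M G (\<lambda>x. f (X i x) * 1) x * nn_cond_exp M G (\<lambda>x. g (X j x)) x"
  proof (rule nn_cond_exp_eq_extend[OF G G, where f=f and X="X i" and Y="X i" and k="\<lambda>_. 1"
      and h="\<lambda>x. g (X j x)" and h'="\<lambda>_. 1"])
    fix A :: "real set" assume A [measurable]: "A \<in> sets borel"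
    have "AE x in M. nn_cond_exp M G (\<lambda>x. g (X j x) * indicator A (X i x)) x * 1
      = nn_cond_exp M G (\<lambda>x. g (X j x) * 1) x * nn_cond_exp M G (\<lambda>x. indicator A (X i x)) x"
    proof (rule nn_cond_exp_eq_extend[OF G G, where f=g and X="X j" and Y="X j" and k="\<lambda>_. 1"
        and h="\<lambda>x. indicator A (X i x)" and h'="\<lambda>_. 1"])
      fix B :: "real set" assume "B \<in> sets borel"
      from ind[OF A this] show "AE x in M. nn_cond_exp M G (\<lambda>x. indicator B (X j x) * indicator A (X i x)) x * 1
        = nn_cond_exp M G (\<lambda>x. indicator B (X j x) * 1) x * nn_cond_exp M G (\<lambda>x. indicator A (X i x)) x"
        by (simp add: mult.commute)
    qed simp_all
    then show "AE x in M. nn_cond_exp M G (\<lambda>x. indicator A (X i x) * g (X j x)) x * 1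
      = nn_cond_exp M G (\<lambda>x. indicator A (X i x) * 1) x * nn_cond_exp M G (\<lambda>x. g (X j x)) x"
      by (simp add: mult.commute)
  qed auto
  then show ?thesis by simp
qed


text \<open>Splitting both variables into positive and negative parts leaves four nonnegative
  products, each covered by the \<open>ennreal\<close> formula. Linearity of the real conditional
  expectation recombines them; this is where integrability enters.\<close>

lemma (in prob_space) cond_indep_vars_real_cond_exp:
  assumes ci: "cond_indep_vars M G X I" and G: "subalgebra M G"
    and ij: "i \<in> I" "j \<in> I" "i \<noteq> j"
    and int: "integrable M (X i)" "integrable M (X j)" "integrable M (\<lambda>x. X i x * X j x)"
  shows "AE x in M. real_cond_exp M G (\<lambda>x. X i x * X j x) x
    = real_cond_exp M G (X i) x * real_cond_exp M G (X j) x"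
proof -
  interpret G: sigma_finite_subalgebra M G by (rule sigma_finite_subalgebraI) fact
  have [measurable]: "X i \<in> borel_measurable M" "X j \<in> borel_measurable M"
    using int by auto
  define p m :: "real \<Rightarrow> real" where "p t = max t 0" and "m t = max (- t) 0" for t
  have p [measurable]: "p \<in> borel_measurable borel" and m [measurable]: "m \<in> borel_measurable borel"
    unfolding p_def m_def by measurable
  have pm: "t = p t - m t" "0 \<le> p t" "0 \<le> m t" "p t \<le> \<bar>t\<bar>" "m t \<le> \<bar>t\<bar>" for t
    by (auto simp: p_def m_def)
  have prod: "AE x in M. real_cond_exp M G (\<lambda>x. a (X i x) * b (X j x)) x
      = real_cond_exp M G (\<lambda>x. a (X i x)) x * real_cond_exp M G (\<lambda>x. b (X j x)) x"
    if [measurable]: "a \<in> borel_measurable borel" "b \<in> borel_measurable borel"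
      and nn: "\<And>t. 0 \<le> a t" "\<And>t. 0 \<le> b t" for a b
  proof -
    have "AE x in M. nn_cond_exp M G (\<lambda>x. ennreal (a (X i x)) * ennreal (b (X j x))) x
      = nn_cond_exp M G (\<lambda>x. ennreal (a (X i x))) x * nn_cond_exp M G (\<lambda>x. ennreal (b (X j x))) x"
      by (rule cond_indep_vars_nn_cond_exp[OF ci G ij]) measurable
    moreover have "AE x in M. real_cond_exp M G (\<lambda>x. a (X i x) * b (X j x)) x
        = enn2real (nn_cond_exp M G (\<lambda>x. ennreal (a (X i x) * b (X j x))) x)"
      by (rule G.real_cond_exp_nonneg) (use nn in auto)
    moreover have "AE x in M. real_cond_exp M G (\<lambda>x. a (X i x)) x
        = enn2real (nn_cond_exp M G (\<lambda>x. ennreal (a (X i x))) x)"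
      by (rule G.real_cond_exp_nonneg) (use nn in auto)
    moreover have "AE x in M. real_cond_exp M G (\<lambda>x. b (X j x)) x
        = enn2real (nn_cond_exp M G (\<lambda>x. ennreal (b (X j x))) x)"
      by (rule G.real_cond_exp_nonneg) (use nn in auto)
    \<comment> \<open>\<open>enn2real\<close> maps infinity to 0 and is multiplicative on all of
      \<open>ennreal\<close>, so the product formula passes directly to the reals.\<close>
    ultimately show ?thesis
      unfolding ennreal_mult[OF nn] by eventually_elim (simp add: enn2real_mult)
  qed
  have I: "integrable M (\<lambda>x. a (X k x))" if "a = p \<or> a = m" "k = i \<or> k = j" for a k
    by (rule Bochner_Integration.integrable_bound[of M "X k"])
       (use that int(1,2) in \<open>auto simp: pm(2-)\<close>)
  have II: "integrable M (\<lambda>x. a (X i x) * b (X j x))"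
    if "a = p \<or> a = m" "b = p \<or> b = m" for a b
    using that int(3)
    by (intro Bochner_Integration.integrable_bound[OF int(3)])
       (auto simp: pm(2-) abs_mult intro!: mult_mono)
  have split: "AE x in M. real_cond_exp M G (X k) x
      = real_cond_exp M G (\<lambda>x. p (X k x)) x - real_cond_exp M G (\<lambda>x. m (X k x)) x"
    if "k = i \<or> k = j" for k
    using G.real_cond_exp_diff[of "\<lambda>x. p (X k x)" "\<lambda>x. m (X k x)"] that by (simp add: I flip: pm(1))
  let ?pp = "\<lambda>x. p (X i x) * p (X j x)" and ?mm = "\<lambda>x. m (X i x) * m (X j x)"
    and ?pm = "\<lambda>x. p (X i x) * m (X j x)" and ?mp = "\<lambda>x. m (X i x) * p (X j x)"
  have "X i x * X j x = (?pp x + ?mm x) - (?pm x + ?mp x)" for x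
    by (subst pm(1)[of "X i x"], subst pm(1)[of "X j x"]) (simp add: algebra_simps)
  then have "AE x in M. real_cond_exp M G (\<lambda>x. X i x * X j x) x
      = real_cond_exp M G (\<lambda>x. ?pp x + ?mm x) x - real_cond_exp M G (\<lambda>x. ?pm x + ?mp x) x"
    by (simp add: II G.real_cond_exp_diff)
  moreover have "AE x in M. real_cond_exp M G (\<lambda>x. ?pp x + ?mm x) x
      = real_cond_exp M G ?pp x + real_cond_exp M G ?mm x"
    "AE x in M. real_cond_exp M G (\<lambda>x. ?pm x + ?mp x) x
      = real_cond_exp M G ?pm x + real_cond_exp M G ?mp x"
    by (intro G.real_cond_exp_add II; simp)+
  ultimately have "AE x in M. real_cond_exp M G (\<lambda>x. X i x * X j x) x
      = real_cond_exp M G ?pp x + real_cond_exp M G ?mm x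
        - (real_cond_exp M G ?pm x + real_cond_exp M G ?mp x)"
    by eventually_elim simp
  with split[OF disjI1[OF refl]] split[OF disjI2[OF refl]]
    prod[OF p p pm(2) pm(2)] prod[OF p m pm(2) pm(3)] prod[OF m p pm(3) pm(2)] prod[OF m m pm(3) pm(3)]
  show ?thesis
    by eventually_elim (simp add: left_diff_distrib right_diff_distrib)
qed

section \<open>Square-integrable functions and orthogonality\<close>

lemma square_integrable_mult:
  assumes "square_integrable M X" "square_integrable M Y"
  shows "integrable M (\<lambda>x. X x * Y x)"
proof (rule Bochner_Integration.integrable_bound)
  show "integrable M (\<lambda>x. (X x)\<^sup>2 + (Y x)\<^sup>2)"
    using assms by (auto simp: square_integrable_def)
  have "2 * \<bar>a * b\<bar> \<le> a\<^sup>2 + b\<^sup>2" for a b :: real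
    using sum_squares_bound[of "\<bar>a\<bar>" "\<bar>b\<bar>"] by (simp add: abs_mult)
  then show "AE x in M. norm (X x * Y x) \<le> norm ((X x)\<^sup>2 + (Y x)\<^sup>2)"
    by (smt (verit) AE_I2 real_norm_def abs_ge_zero)
qed (use assms in \<open>auto simp: square_integrable_def\<close>)

lemma square_integrable_add:
  assumes "square_integrable M X" "square_integrable M Y"
  shows "square_integrable M (\<lambda>x. X x + Y x)"
  using assms square_integrable_mult[OF assms]
  by (auto simp: square_integrable_def power2_sum mult.assoc)

lemma square_integrable_diff:
  assumes "square_integrable M X" "square_integrable M Y"
  shows "square_integrable M (\<lambda>x. X x - Y x)"
  using assms square_integrable_mult[OF assms]
  by (auto simp: square_integrable_def power2_diff mult.assoc)

lemma square_integrable_sum: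
  assumes "\<And>i. i \<in> I \<Longrightarrow> square_integrable M (X i)"
  shows "square_integrable M (\<lambda>x. \<Sum>i\<in>I. X i x)"
  using assms
proof (induction I rule: infinite_finite_induct)
  case (insert i I)
  then show ?case by (simp add: square_integrable_add)
qed (simp_all add: square_integrable_def)

lemma (in finite_measure) square_integrable_const: "square_integrable M (\<lambda>x. c)"
  by (simp add: square_integrable_def)

lemma (in finite_measure) square_integrable_integrable:
  "square_integrable M X \<Longrightarrow> integrable M X"
  using square_integrable_mult[OF _ square_integrable_const[of 1], of X] by simp

text \<open>Conditional Jensen inequality for the convex function \<open>t\<^sup>2\<close>.\<close>

lemma (in prob_space) square_integrable_real_cond_exp:
  assumes "subalgebra M H" "square_integrable M X"
  shows "square_integrable M (real_cond_exp M H X)"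
proof -
  interpret H: sigma_finite_subalgebra M H by (rule sigma_finite_subalgebraI) fact
  have "integrable M (\<lambda>x. (real_cond_exp M H X x)\<^sup>2)"
    using assms(2) square_integrable_integrable[OF assms(2)]
    by (intro H.integrable_convex_cond_exp[where I=UNIV])
       (auto simp: square_integrable_def convex_power2)
  then show ?thesis by (simp add: square_integrable_def)
qed

text \<open>Conditional expectation is the orthogonal projection onto the square-integrable
  \<open>H\<close>-measurable functions, so the residual is orthogonal to each of them. Constant
  \<open>Z\<close> yields that the residual is centered.\<close>

lemma (in prob_space) integral_mult_cond_centered:
  assumes H: "subalgebra M H" and X: "square_integrable M X"
    and Z: "square_integrable M Z" "Z \<in> borel_measurable H"
  shows "(\<integral>x. Z x * (X x - real_cond_exp M H X x) \<partial>M) = 0"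
proof -
  interpret H: sigma_finite_subalgebra M H by (rule sigma_finite_subalgebraI) fact
  show ?thesis
    using H.real_cond_exp_intg[OF square_integrable_mult[OF Z(1) X] Z(2)] X
      square_integrable_mult[OF Z(1) X]
    by (simp add: square_integrable_def right_diff_distrib)
qed

text \<open>Pythagoras for this projection: the residual is orthogonal to the conditional mean
  itself.\<close>

lemma (in prob_space) integral_cond_centered_sq:
  assumes H: "subalgebra M H" and X: "square_integrable M X"
  shows "(\<integral>x. (X x - real_cond_exp M H X x)\<^sup>2 \<partial>M)
    = (\<integral>x. (X x)\<^sup>2 \<partial>M) - (\<integral>x. (real_cond_exp M H X x)\<^sup>2 \<partial>M)"
proof -
  let ?m = "real_cond_exp M H X"
  note m = square_integrable_real_cond_exp[OF H X]
  have "(\<integral>x. (X x - ?m x)\<^sup>2 \<partial>M)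
    = (\<integral>x. ((X x)\<^sup>2 - (?m x)\<^sup>2) - 2 * (?m x * (X x - ?m x)) \<partial>M)"
    by (rule Bochner_Integration.integral_cong) (auto simp: power2_eq_square algebra_simps)
  also have "\<dots> = (\<integral>x. (X x)\<^sup>2 - (?m x)\<^sup>2 \<partial>M) - 2 * (\<integral>x. ?m x * (X x - ?m x) \<partial>M)"
    using X m square_integrable_mult[OF m square_integrable_diff[OF X m]]
    by (subst Bochner_Integration.integral_diff) (auto simp: square_integrable_def)
  finally show ?thesis
    using integral_mult_cond_centered[OF H X m] X m by (simp add: square_integrable_def)
qed

lemma integral_sum_sq_orthogonal:
  assumes "finite I" and Z: "\<And>i. i \<in> I \<Longrightarrow> square_integrable M (Z i)"
    and orth: "\<And>i j. i \<in> I \<Longrightarrow> j \<in> I \<Longrightarrow> i \<noteq> j \<Longrightarrow> (\<integral>x. Z i x * Z j x \<partial>M) = 0"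
  shows "(\<integral>x. (\<Sum>i\<in>I. Z i x)\<^sup>2 \<partial>M) = (\<Sum>i\<in>I. \<integral>x. (Z i x)\<^sup>2 \<partial>M)"
proof -
  have "(\<integral>x. (\<Sum>i\<in>I. Z i x)\<^sup>2 \<partial>M) = (\<Sum>i\<in>I. \<Sum>j\<in>I. \<integral>x. Z i x * Z j x \<partial>M)"
    using square_integrable_mult[OF Z Z]
    by (simp add: power2_eq_square sum_product)
  also have "\<dots> = (\<Sum>i\<in>I. \<Sum>j\<in>I. if i = j then \<integral>x. (Z i x)\<^sup>2 \<partial>M else 0)"
    by (intro sum.cong refl) (auto simp: orth power2_eq_square)
  finally show ?thesis using \<open>finite I\<close> by simp
qed

section \<open>Variance of a centered part plus a conditional-mean part\<close>

text \<open>Source of the factor 2: (a + b)^2 \<le> 2 a^2 + 2 b^2 with b the centered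
  \<open>T\<close>. \<open>S\<close> and \<open>T\<close> may be correlated here, as happens for the
  sum of the \<open>d i\<close>.\<close>

lemma (in prob_space) variance_add_le:
  assumes S: "square_integrable M S" "expectation S = 0" and T: "square_integrable M T"
  shows "variance (\<lambda>x. S x + T x) \<le> 2 * expectation (\<lambda>x. (S x)\<^sup>2) + 2 * variance T"
proof -
  note int = square_integrable_integrable[OF S(1)] square_integrable_integrable[OF T]
  let ?c = "expectation T"
  have T': "integrable M (\<lambda>x. (T x - ?c)\<^sup>2)"
    using square_integrable_diff[OF T square_integrable_const[of ?c]]
    by (simp add: square_integrable_def)
  have ST: "integrable M (\<lambda>x. (S x + (T x - ?c))\<^sup>2)"
    using square_integrable_add[OF S(1) square_integrable_diff[OF T square_integrable_const[of ?c]]]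
    by (simp add: square_integrable_def)
  have S': "integrable M (\<lambda>x. (S x)\<^sup>2)"
    using S by (simp add: square_integrable_def)
  have "variance (\<lambda>x. S x + T x) = expectation (\<lambda>x. (S x + (T x - ?c))\<^sup>2)"
    using int S by (simp add: algebra_simps)
  also have "\<dots> \<le> expectation (\<lambda>x. 2 * (S x)\<^sup>2 + 2 * (T x - ?c)\<^sup>2)"
  proof (rule integral_mono)
    fix x
    show "(S x + (T x - ?c))\<^sup>2 \<le> 2 * (S x)\<^sup>2 + 2 * (T x - ?c)\<^sup>2"
      using sum_squares_bound[of "S x" "T x - ?c"] by (simp add: power2_sum)
  qed (use ST S' T' in auto)
  finally show ?thesis using S' T' by simp
qed

text \<open>The exact counterpart for the decoupled sum. As \<open>S\<close> is centered,
  \<open>orth\<close> says that the covariance of \<open>S\<close> and \<open>T\<close> is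
  0.\<close>

lemma (in prob_space) variance_add_orthogonal:
  assumes S: "square_integrable M S" "expectation S = 0" and T: "square_integrable M T"
    and orth: "expectation (\<lambda>x. T x * S x) = 0"
  shows "variance (\<lambda>x. S x + T x) = expectation (\<lambda>x. (S x)\<^sup>2) + variance T"
proof -
  have "variance (\<lambda>x. S x + T x)
      = expectation (\<lambda>x. (S x + T x)\<^sup>2) - (expectation (\<lambda>x. S x + T x))\<^sup>2"
    using square_integrable_add[OF S(1) T]
    by (intro variance_eq) (auto simp: square_integrable_integrable square_integrable_def)
  moreover have "expectation (\<lambda>x. (S x + T x)\<^sup>2)
      = expectation (\<lambda>x. (S x)\<^sup>2) + expectation (\<lambda>x. (T x)\<^sup>2)"
    using S T orth square_integrable_mult[OF T S(1)]
    by (simp add: square_integrable_def power2_sum mult.assoc mult.commute[of "S _"])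
  moreover have "expectation (\<lambda>x. S x + T x) = expectation T"
    using S T by (simp add: square_integrable_integrable)
  moreover have "variance T = expectation (\<lambda>x. (T x)\<^sup>2) - (expectation T)\<^sup>2"
    using T by (intro variance_eq) (auto simp: square_integrable_integrable square_integrable_def)
  ultimately show ?thesis by simp
qed

section \<open>The variance comparison\<close>

theorem theorem3p3:
  fixes M :: "'a measure" and F :: "nat \<Rightarrow> 'a measure" and G :: "'a measure"
    and d e :: "nat \<Rightarrow> 'a \<Rightarrow> real" and n :: nat
  assumes "prob_space M"
    and "sigma_filtration M n F"
    and "adapted_seq n F d"
    and "adapted_seq n F e"
    and "\<And>i. i \<in> {1..n} \<Longrightarrow> square_integrable M (d i)"
    and "\<And>i. i \<in> {1..n} \<Longrightarrow> square_integrable M (e i)"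
    and "decoupled_seq M n F G d e"
  shows "prob_space.variance M (\<lambda>\<omega>. \<Sum>i=1..n. d i \<omega>)
           \<le> 2 * prob_space.variance M (\<lambda>\<omega>. \<Sum>i=1..n. e i \<omega>)"
proof -
  interpret prob_space M by fact
  define u where "u i = real_cond_exp M (F (i - 1)) (d i)" for i
  define v where "v i = real_cond_exp M G (e i)" for i
  note d = assms(5) and e = assms(6)
  have F: "subalgebra M (F (i - 1))" if "i \<in> {1..n}" for i
    using assms(2) that by (auto simp: sigma_filtration_def)
  have G: "subalgebra M G" and ci: "cond_indep_vars M G e {1..n}"
    using assms(7) by (auto simp: decoupled_seq_def CI_given_def)
  interpret G: sigma_finite_subalgebra M G by (rule sigma_finite_subalgebraI) fact
  \<comment> \<open>Tangency leads from \<open>d i\<close> given \<open>F (i - 1)\<close> to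
    \<open>e i\<close> given \<open>F (i - 1)\<close>, and the CI property from there to
    \<open>e i\<close> given \<open>G\<close>.\<close>
  have cexp: "AE x in M. real_cond_exp M (F (i - 1)) (\<lambda>x. \<phi> (d i x)) x
      = real_cond_exp M G (\<lambda>x. \<phi> (e i x)) x"
    if i: "i \<in> {1..n}" and \<phi>: "\<phi> \<in> borel_measurable borel" for i \<phi>
  proof -
    have "cond_law_eq M (F (i - 1)) (d i) (F (i - 1)) (e i)"
      "cond_law_eq M (F (i - 1)) (e i) G (e i)"
      using assms(7) i by (auto simp: decoupled_seq_def CI_given_def tangent_def)
    then have "cond_law_eq M (F (i - 1)) (d i) G (e i)"
      unfolding cond_law_eq_def by fastforce
    then show ?thesis
      using d[OF i] e[OF i] F[OF i] G \<phi>
      by (intro cond_law_eq_real_cond_exp) (auto simp: square_integrable_def)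
  qed
  have uv: "AE x in M. u i x = v i x" if "i \<in> {1..n}" for i
    using cexp[OF that, of "\<lambda>t. t"] by (simp add: u_def v_def)
  have u: "square_integrable M (u i)" and v: "square_integrable M (v i)" if "i \<in> {1..n}" for i
    using d e F G that by (auto simp: u_def v_def intro!: square_integrable_real_cond_exp)
  have du: "square_integrable M (\<lambda>x. d i x - u i x)"
    and ev: "square_integrable M (\<lambda>x. e i x - v i x)" if "i \<in> {1..n}" for i
    using that by (auto intro!: square_integrable_diff d e u v)

  \<comment> \<open>By Pythagoras it is enough to match the second moments of \<open>d i\<close> and
    \<open>e i\<close> and those of their conditional means; \<open>cexp\<close> with the square
    gives the former, \<open>uv\<close> the latter.\<close>
  have du_ev: "expectation (\<lambda>x. (d i x - u i x)\<^sup>2) = expectation (\<lambda>x. (e i x - v i x)\<^sup>2)"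
    if i: "i \<in> {1..n}" for i
  proof -
    interpret Fi: sigma_finite_subalgebra M "F (i - 1)" by (rule sigma_finite_subalgebraI) (rule F[OF i])
    have "expectation (\<lambda>x. (d i x)\<^sup>2) = expectation (real_cond_exp M (F (i - 1)) (\<lambda>x. (d i x)\<^sup>2))"
      using d[OF i] by (intro Fi.real_cond_exp_int(2)[symmetric]) (simp add: square_integrable_def)
    also have "\<dots> = expectation (real_cond_exp M G (\<lambda>x. (e i x)\<^sup>2))"
      using cexp[OF i, of "\<lambda>t. t\<^sup>2"] by (intro integral_cong_AE) auto
    also have "\<dots> = expectation (\<lambda>x. (e i x)\<^sup>2)"
      using e[OF i] by (simp add: G.real_cond_exp_int square_integrable_def)
    moreover have "expectation (\<lambda>x. (u i x)\<^sup>2) = expectation (\<lambda>x. (v i x)\<^sup>2)"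
      using uv[OF i] u[OF i] v[OF i] by (intro integral_cong_AE) (auto simp: square_integrable_def)
    ultimately show ?thesis
      using integral_cond_centered_sq[OF F[OF i] d[OF i]] integral_cond_centered_sq[OF G e[OF i]]
      by (simp add: u_def v_def)
  qed

  have du_lt: "expectation (\<lambda>x. (d i x - u i x) * (d j x - u j x)) = 0"
    if i: "i \<in> {1..n}" and j: "j \<in> {1..n}" and "i < j" for i j
    unfolding u_def[of j]
  proof (rule integral_mult_cond_centered[OF F[OF j] d[OF j] du[OF i]])
    \<comment> \<open>From \<open>i < j\<close> follows \<open>i \<le> j - 1\<close>, so the whole
      earlier difference is known at time \<open>j - 1\<close>, and the residual of
      \<open>d j\<close> is orthogonal to it.\<close>
    have "subalgebra (F (j - 1)) (F i)" "subalgebra (F (j - 1)) (F (i - 1))"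
      using assms(2) i j \<open>i < j\<close> by (auto simp: sigma_filtration_def subalgebra_def)
    moreover have "d i \<in> borel_measurable (F i)"
      using assms(3) i by (auto simp: adapted_seq_def)
    ultimately show "(\<lambda>x. d i x - u i x) \<in> borel_measurable (F (j - 1))"
      unfolding u_def
      by (intro borel_measurable_diff) (auto intro: measurable_from_subalg)
  qed
  have du_orth: "expectation (\<lambda>x. (d i x - u i x) * (d j x - u j x)) = 0"
    if "i \<in> {1..n}" "j \<in> {1..n}" "i \<noteq> j" for i j
    using du_lt[of i j] du_lt[of j i] that by (cases i j rule: linorder_cases) (auto simp: mult.commute)
  have ev_orth: "expectation (\<lambda>x. (e i x - v i x) * (e j x - v j x)) = 0"
    if i: "i \<in> {1..n}" and j: "j \<in> {1..n}" and ij: "i \<noteq> j" for i j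
  proof -
    \<comment> \<open>Conditional independence turns the conditional mean of
      \<open>e i * e j\<close> into \<open>v i * v j\<close>; taking expectations removes the
      conditioning.\<close>
    have e_mult: "expectation (\<lambda>x. e i x * e j x) = expectation (\<lambda>x. v i x * v j x)"
    proof -
      have "expectation (\<lambda>x. e i x * e j x) = expectation (real_cond_exp M G (\<lambda>x. e i x * e j x))"
        using square_integrable_mult[OF e[OF i] e[OF j]] by (simp add: G.real_cond_exp_int)
      also have "\<dots> = expectation (\<lambda>x. v i x * v j x)"
        using cond_indep_vars_real_cond_exp[OF ci G i j ij] e[OF i] e[OF j]
        by (intro integral_cong_AE)
           (simp_all add: v_def square_integrable_integrable square_integrable_mult)
      finally show ?thesis .
    qed
    have "expectation (\<lambda>x. v i x * (e j x - v j x)) = 0" "expectation (\<lambda>x. v j x * (e i x - v i x)) = 0"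
      using integral_mult_cond_centered[OF G e[OF j] v[OF i]]
        integral_mult_cond_centered[OF G e[OF i] v[OF j]] by (auto simp: v_def)
    \<comment> \<open>Neither factor has to be \<open>G\<close>-measurable, so the product is
      rearranged: the first two terms cancel in expectation by \<open>e_mult\<close>, and each of
      the last two pairs a \<open>G\<close>-measurable function with a residual.\<close>
    moreover have "(e i x - v i x) * (e j x - v j x)
      = e i x * e j x - v i x * v j x - v i x * (e j x - v j x) - v j x * (e i x - v i x)" for x
      by (simp add: algebra_simps)
    ultimately show ?thesis
      using e_mult square_integrable_mult[OF e[OF i] e[OF j]] square_integrable_mult[OF v[OF i] v[OF j]]
        square_integrable_mult[OF v[OF i] ev[OF j]] square_integrable_mult[OF v[OF j] ev[OF i]]
      by simp
  qed

  let ?S = "\<lambda>x. \<Sum>i=1..n. d i x - u i x" and ?T = "\<lambda>x. \<Sum>i=1..n. u i x"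
    and ?S' = "\<lambda>x. \<Sum>i=1..n. e i x - v i x" and ?T' = "\<lambda>x. \<Sum>i=1..n. v i x"
  have SS': "expectation (\<lambda>x. (?S x)\<^sup>2) = expectation (\<lambda>x. (?S' x)\<^sup>2)"
  proof -
    have "expectation (\<lambda>x. (?S x)\<^sup>2) = (\<Sum>i=1..n. expectation (\<lambda>x. (d i x - u i x)\<^sup>2))"
      by (intro integral_sum_sq_orthogonal finite_atLeastAtMost du du_orth)
    also have "\<dots> = (\<Sum>i=1..n. expectation (\<lambda>x. (e i x - v i x)\<^sup>2))"
      by (intro sum.cong refl du_ev)
    also have "\<dots> = expectation (\<lambda>x. (?S' x)\<^sup>2)"
      by (intro integral_sum_sq_orthogonal[symmetric] finite_atLeastAtMost ev ev_orth)
    finally show ?thesis .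
  qed
  \<comment> \<open>\<open>?T\<close> is replaced by its version \<open>?T'\<close>, which is
    measurable for \<open>G\<close> itself, as the orthogonality to \<open>?S'\<close>
    requires.\<close>
  have "AE x in M. ?T x = ?T' x"
  proof -
    have "AE x in M. \<forall>i\<in>{1..n}. u i x = v i x"
      by (intro AE_finite_allI finite_atLeastAtMost uv)
    then show ?thesis
      by eventually_elim (rule sum.cong; simp)
  qed
  moreover have T: "square_integrable M ?T" and T': "square_integrable M ?T'"
    by (intro square_integrable_sum u v; assumption)+
  ultimately have "expectation ?T = expectation ?T'"
    by (intro integral_cong_AE) (auto simp: square_integrable_def)
  with \<open>AE x in M. ?T x = ?T' x\<close> have TT': "variance ?T = variance ?T'"
    using T T' by (intro integral_cong_AE) (auto simp: square_integrable_def)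
  have S: "square_integrable M ?S" and S': "square_integrable M ?S'"
    by (intro square_integrable_sum du ev; assumption)+
  have "expectation (\<lambda>x. d i x - u i x) = 0" if i: "i \<in> {1..n}" for i
    using integral_mult_cond_centered[OF F[OF i] d[OF i] square_integrable_const[of 1]]
    by (simp add: u_def)
  then have ES: "expectation ?S = 0"
    by (simp add: Bochner_Integration.integral_sum square_integrable_integrable[OF du])
  \<comment> \<open>Used twice at the end: \<open>Z = 1\<close> shows that \<open>?S'\<close> is
    centered, and \<open>Z = ?T'\<close> that it is orthogonal to \<open>?T'\<close>.\<close>
  have ev0: "expectation (\<lambda>x. Z x * ?S' x) = 0"
    if Z: "square_integrable M Z" "Z \<in> borel_measurable G" for Z
  proof -
    have "expectation (\<lambda>x. Z x * (e i x - v i x)) = 0" if "i \<in> {1..n}" for i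
      using integral_mult_cond_centered[OF G e[OF that] Z] by (simp add: v_def)
    then show ?thesis
      by (simp add: sum_distrib_left Bochner_Integration.integral_sum square_integrable_mult[OF Z(1) ev])
  qed
  have "variance (\<lambda>x. \<Sum>i=1..n. d i x) = variance (\<lambda>x. ?S x + ?T x)"
    by (simp add: sum_subtractf)
  also have "\<dots> \<le> 2 * expectation (\<lambda>x. (?S x)\<^sup>2) + 2 * variance ?T"
    by (rule variance_add_le[OF S ES T])
  also have "\<dots> = 2 * (expectation (\<lambda>x. (?S' x)\<^sup>2) + variance ?T')"
    by (simp only: SS' TT' distrib_left)
  also have "expectation (\<lambda>x. (?S' x)\<^sup>2) + variance ?T' = variance (\<lambda>x. ?S' x + ?T' x)"
    using ev0[OF square_integrable_const[of 1]] ev0[OF T']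
    by (intro variance_add_orthogonal[symmetric] S' T') (auto simp: v_def)
  also have "\<dots> = variance (\<lambda>x. \<Sum>i=1..n. e i x)"
    by (simp add: sum_subtractf)
  finally show ?thesis .
qed

end
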